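(* Let $n,p\ge 1$ be integers, let $\mathbb{X}\in\mathbb{R}^{n\times p}$, $\mathbf{f}\in\mathbb{R}^n$, $\sigma>0$, $\boldsymbol{\xi}\sim\mathcal N(\mathbf 0,\sigma^2 I_{n\times n})$, and $\mathbf y=\mathbf f+\boldsymbol\xi$. Let $F:\mathbb{R}^p\to[0,+\infty]$ be a proper convex function, and for each $\mathbf y\in\mathbb{R}^n$ let $\hat{\boldsymbol\beta}(\mathbf y)$ be a solution of $$\hat{\boldsymbol\beta}(\mathbf y)\in\operatorname*{argmin}_{\boldsymbol\beta\in\mathbb{R}^p}\left(\|\mathbf y-\mathbb X\boldsymbol\beta\|^2+2F(\boldsymbol\beta)\right).$$ Then for all $x>0$, $$\mathbb P\left(\|\mathbb X\hat{\boldsymbol\beta}(\mathbf y)-\mathbf f\|\le \mathbb E\|\mathbb X\hat{\boldsymbol\beta}(\mathbf y)-\mathbf f\|+\sigma\sqrt{2x/n}\right)\ge1-e^{-x}$$ and $$\mathbb P\left(\|\mathbb X\hat{\boldsymbol\beta}(\mathbf y)-\mathbf f\|\ge \mathbb E\|\mathbb X\hat{\boldsymbol\beta}(\mathbf y)-\mathbf f\|-\sigma\sqrt{2x/n}\right)\ge1-e^{-x}.$$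
   Context: For $\mathbf u\in\mathbb R^n$, $\|\mathbf u\|$ denotes the scaled Euclidean norm, $\|\mathbf u\|^2=\frac1n\sum_{i=1}^n u_i^2$. A proper convex function $F:\mathbb R^p\to[0,+\infty]$ is a nonnegative convex function with $F(\boldsymbol\beta)<+\infty$ for at least one $\boldsymbol\beta$. It is assumed that a minimizer $\hat{\boldsymbol\beta}(\mathbf y)$ exists for every $\mathbf y\in\mathbb R^n$ (any choice of minimizer is allowed). *)

theory Defs
  imports "HOL-Probability.Probability"
begin

definition scaled_norm :: "real ^ 'n \<Rightarrow> real" where
  "scaled_norm u = sqrt ((\<Sum>i\<in>UNIV. (u $ i)\<^sup>2) / real CARD('n))"

text \<open>The library's \<^const>\<open>convex_on\<close> is restricted to real-valued functions.
  Extended-valued convexity uses \<open>0 * \<infinity> = 0\<close>; this only matters for \<open>t = 0\<close> and \<open>t = 1\<close>,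
  where the inequality is trivial.\<close>

definition proper_convex :: "('a::real_vector \<Rightarrow> ennreal) \<Rightarrow> bool" where
  "proper_convex F \<longleftrightarrow>
     (\<exists>b. F b < \<infinity>) \<and>
     (\<forall>a b. \<forall>t\<in>{0..1}.
        F (t *\<^sub>R a + (1 - t) *\<^sub>R b) \<le> ennreal t * F a + ennreal (1 - t) * F b)"

text \<open>The law $N(0, \sigma^2 I)$ for \<open>\<sigma> > 0\<close>, given by its Lebesgue density.\<close>

definition isotropic_normal :: "'a measure \<Rightarrow> real \<Rightarrow> ('a \<Rightarrow> real ^ 'n) \<Rightarrow> bool" where
  "isotropic_normal M \<sigma> \<xi> \<longleftrightarrow>
     distributed M lborel \<xi> (\<lambda>v. ennreal (\<Prod>i\<in>UNIV. normal_density 0 \<sigma> (v $ i)))"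

definition penalized_objective ::
    "real ^ 'p ^ 'n \<Rightarrow> (real ^ 'p \<Rightarrow> ennreal) \<Rightarrow> real ^ 'n \<Rightarrow> real ^ 'p \<Rightarrow> ennreal" where
  "penalized_objective X F y b = ennreal ((scaled_norm (y - X *v b))\<^sup>2) + 2 * F b"

end

theory Submission imports Defs begin

text \<open>
  A minimizer of a penalized least squares problem satisfies a variational inequality, and adding
  the inequalities for two data vectors shows that the fitted value is a nonexpansive function of
  the data. So the loss is a Lipschitz function of the Gaussian noise with constant \<open>1 / sqrt n\<close>
  for the unscaled norm, and Gaussian concentration with the sharp constant applies.

  The concentration comes from the dual form of Talagrand's transport inequality: if
  \<open>g x \<le> f y + \<bar>x - y\<bar>\<^sup>2 / (2 \<sigma>\<^sup>2)\<close> for all \<open>x, y\<close>, then \<open>E exp g \<le> exp (E f)\<close>. In dimension one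
  it follows from monotone transport, and it tensorizes by applying it to one coordinate at a time.
  The choice \<open>f = h\<close>, \<open>g = h - L\<^sup>2 \<sigma>\<^sup>2 / 2\<close> for an \<open>L\<close>-Lipschitz \<open>h\<close> bounds the Laplace transform of \<open>h\<close>.
\<close>

subsection \<open>The infimum-convolution inequality\<close>

text \<open>With \<open>A\<close> and \<open>B\<close> the cumulative integrals of the two
  densities, \<open>T\<close> is the inverse of \<open>B\<close> after \<open>A\<close>. Both
  increase from 0 to the same total mass, so \<open>T\<close> maps the interval to itself and fixes
  its end points. The inverse function rule then gives the one-dimensional Monge-Ampere equation
  \<open>b (T x) * T' x = a x\<close>.\<close>

lemma monotone_transport:
  fixes a b :: "real \<Rightarrow> real"
  assumes lr: "l < r"
    and a: "continuous_on {l..r} a" "\<And>x. x \<in> {l..r} \<Longrightarrow> 0 < a x"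
    and b: "continuous_on {l..r} b" "\<And>x. x \<in> {l..r} \<Longrightarrow> 0 < b x"
    and mass: "integral {l..r} a = integral {l..r} b"
  obtains T where "continuous_on {l..r} T" "T l = l" "T r = r" "T ` {l..r} \<subseteq> {l..r}"
    "\<And>x. x \<in> {l<..<r} \<Longrightarrow> (T has_real_derivative a x / b (T x)) (at x)"
proof -
  define A B where "A = (\<lambda>x. integral {l..x} a)" and "B = (\<lambda>x. integral {l..x} b)"
  have cont: "continuous_on {l..r} (\<lambda>x. integral {l..x} c)"
    and der: "\<And>x. x \<in> {l..r} \<Longrightarrow> ((\<lambda>x. integral {l..x} c) has_real_derivative c x) (at x within {l..r})"
    if "continuous_on {l..r} c" for c :: "real \<Rightarrow> real"
    using that integral_has_real_derivative[OF that]
    by (auto intro: indefinite_integral_continuous_1 integrable_continuous_interval)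
  have mono: "integral {l..x} c < integral {l..y} c"
    if c: "continuous_on {l..r} c" "\<And>x. x \<in> {l..r} \<Longrightarrow> 0 < c x" and xy: "l \<le> x" "x < y" "y \<le> r"
    for c :: "real \<Rightarrow> real" and x y
  proof (rule DERIV_pos_imp_increasing_open[OF xy(2)])
    fix z assume z: "x < z" "z < y"
    then have "((\<lambda>x. integral {l..x} c) has_real_derivative c z) (at z)"
      using der[OF c(1), of z] xy by (simp add: at_within_Icc_at)
    then show "\<exists>d. ((\<lambda>x. integral {l..x} c) has_real_derivative d) (at z) \<and> d > 0"
      using c(2)[of z] z xy by auto
  next
    show "continuous_on {x..y} (\<lambda>x. integral {l..x} c)"
      using cont[OF c(1)] xy by (elim continuous_on_subset) auto
  qed
  have contA: "continuous_on {l..r} A" and contB: "continuous_on {l..r} B"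
    using cont[OF a(1)] cont[OF b(1)] by (simp_all add: A_def B_def)
  have A_mono: "\<And>x y. l \<le> x \<Longrightarrow> x < y \<Longrightarrow> y \<le> r \<Longrightarrow> A x < A y"
    and B_mono: "\<And>x y. l \<le> x \<Longrightarrow> x < y \<Longrightarrow> y \<le> r \<Longrightarrow> B x < B y"
    using mono[OF a] mono[OF b] by (auto simp: A_def B_def)
  have ends: "A l = 0" "B l = 0" "A r = B r"
    using mass by (auto simp: A_def B_def)
  have injB: "inj_on B {l..r}"
    by (rule linorder_inj_onI) (use B_mono in force)+
  define T where "T = (\<lambda>x. the_inv_into {l..r} B (A x))"
  have imB: "B ` {l..r} = {0..B r}"
  proof (intro equalityI subsetI)
    fix u assume "u \<in> {0..B r}"
    then show "u \<in> B ` {l..r}"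
      using IVT'[of B l u r] lr contB ends by force
  next
    fix u assume "u \<in> B ` {l..r}"
    then show "u \<in> {0..B r}"
      using B_mono ends by (force simp: less_eq_real_def)
  qed
  have imA: "A x \<in> {0..B r}" if "x \<in> {l..r}" for x
    using that A_mono[of l x] A_mono[of x r] ends by (force simp: less_eq_real_def)
  have T_in: "T x \<in> {l..r}" and BT: "B (T x) = A x" if "x \<in> {l..r}" for x
    using the_inv_into_into[OF injB, of "A x" "{l..r}"] f_the_inv_into_f[OF injB, of "A x"]
      imA[OF that] imB by (auto simp: T_def)
  have TB: "the_inv_into {l..r} B (B x) = x" if "x \<in> {l..r}" for x
    by (rule the_inv_into_f_f[OF injB that])
  have T_ends: "T l = l" "T r = r"
    using TB[of l] TB[of r] lr ends by (auto simp: T_def)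
  have cont_inv: "continuous_on {0..B r} (the_inv_into {l..r} B)"
    using continuous_on_inv[OF contB compact_Icc] TB imB by auto
  have contT: "continuous_on {l..r} T"
    unfolding T_def by (rule continuous_on_compose2[OF cont_inv contA]) (use imA in auto)
  have "(T has_real_derivative a x / b (T x)) (at x)" if x: "x \<in> {l<..<r}" for x
  proof -
    have "0 < A x" "A x < B r"
      using A_mono[of l x] A_mono[of x r] x ends by auto
    then have Ax: "A x \<in> {0<..<B r}" by simp
    \<comment> \<open>At an end point \<open>B (T x)\<close> would be 0 or \<open>B r\<close>,
      values that \<open>A x\<close> avoids. So \<open>T x\<close> is interior and \<open>B\<close>
      has a two-sided derivative there.\<close>
    have "T x \<noteq> l" "T x \<noteq> r" "l \<le> T x" "T x \<le> r"
      using BT[of x] T_in[of x] x Ax ends by auto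
    then have Tx: "T x \<in> {l<..<r}" by auto
    have dA: "(A has_real_derivative a x) (at x)"
      using der[OF a(1), of x] x by (simp add: A_def at_within_Icc_at)
    have dB: "(B has_real_derivative b (T x)) (at (T x))"
      using der[OF b(1), of "T x"] Tx by (simp add: B_def at_within_Icc_at)
    have "(the_inv_into {l..r} B has_real_derivative inverse (b (T x))) (at (A x))"
    proof (rule DERIV_inverse_function[where f = B and a = 0 and b = "B r"])
      show "DERIV B (the_inv_into {l..r} B (A x)) :> b (T x)" using dB by (simp add: T_def)
      show "b (T x) \<noteq> 0" using b(2)[of "T x"] Tx by auto
      show "isCont (the_inv_into {l..r} B) (A x)"
        using continuous_on_interior[OF cont_inv, of "A x"] Ax by simp
      show "B (the_inv_into {l..r} B y) = y" if "0 < y" "y < B r" for y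
        using f_the_inv_into_f[OF injB, of y] imB that by auto
    qed (use Ax in auto)
    from DERIV_chain2[OF this dA] show ?thesis
      by (simp add: T_def[abs_def] field_simps)
  qed
  then show thesis
    using that[of T] contT T_ends T_in by blast
qed

text \<open>Reading off the normalizing constant from the change-of-variables formula for \<open>T\<close>
  and using \<open>ln s \<le> s - 1\<close>, the integrand splits into \<open>f\<close> plus the derivative of
  \<open>(T x - x) * w x\<close>. On a compact interval \<open>T\<close> fixes both end points, so that
  derivative integrates to \<open>0\<close>.\<close>

lemma interval_infimum_convolution:
  fixes f g w :: "real \<Rightarrow> real"
  assumes lr: "l < r" and s: "\<sigma> > 0"
    and w_def: "\<And>x. w x = exp (- (x\<^sup>2) / (2 * \<sigma>\<^sup>2))"
    and g: "continuous_on {l..r} g"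
    and f: "(\<lambda>x. f x * w x) integrable_on {l..r}"
    and le: "\<And>x y. x \<in> {l..r} \<Longrightarrow> y \<in> {l..r} \<Longrightarrow> g x \<le> f y + (x - y)\<^sup>2 / (2 * \<sigma>\<^sup>2)"
  shows "integral {l..r} (\<lambda>x. exp (g x) * w x)
    \<le> integral {l..r} w * exp (integral {l..r} (\<lambda>x. f x * w x) / integral {l..r} w)"
proof -
  define m Z where "m = integral {l..r} w" and "Z = integral {l..r} (\<lambda>x. exp (g x) * w x)"
  have w_pos: "w x > 0" for x by (simp add: w_def)
  have contw: "continuous_on S w" for S
    unfolding w_def[abs_def] using s by (intro continuous_intros) auto
  have conte: "continuous_on {l..r} (\<lambda>x. exp (g x) * w x)"
    by (intro continuous_intros g contw)
  have integral_pos: "integral {l..r} c > 0"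
    if "continuous_on {l..r} c" "\<And>x. c x > 0" for c :: "real \<Rightarrow> real"
  proof -
    have "integral {l..r} c \<ge> 0"
      using that by (intro integral_nonneg integrable_continuous_interval) (auto intro: less_imp_le)
    moreover have "integral {l..r} c \<noteq> 0"
      using integral_eq_0_iff[OF that(1) lr] that(2) lr
      by (metis atLeastAtMost_iff less_eq_real_def order_less_irrefl)
    ultimately show ?thesis by simp
  qed
  have m: "m > 0" unfolding m_def by (rule integral_pos[OF contw w_pos])
  have Z: "Z > 0" unfolding Z_def by (rule integral_pos[OF conte]) (simp add: w_pos)
  \<comment> \<open>\<open>T\<close> transports the normalized weight \<open>w / m\<close> to the
    density \<open>exp g * w / Z\<close> tilted by \<open>g\<close>.\<close>
  obtain T where T: "continuous_on {l..r} T" "T l = l" "T r = r" "T ` {l..r} \<subseteq> {l..r}"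
    and dT: "\<And>x. x \<in> {l<..<r} \<Longrightarrow>
      (T has_real_derivative (w x / m) / (exp (g (T x)) * w (T x) / Z)) (at x)"
  proof (rule monotone_transport[OF lr, of "\<lambda>x. w x / m" "\<lambda>x. exp (g x) * w x / Z"])
    show "integral {l..r} (\<lambda>x. w x / m) = integral {l..r} (\<lambda>x. exp (g x) * w x / Z)"
      using m Z by (simp add: m_def[symmetric] Z_def[symmetric])
  qed (use m Z w_pos in \<open>auto intro!: continuous_intros contw g\<close>)
  define T' where "T' x = (w x / m) / (exp (g (T x)) * w (T x) / Z)" for x
  define D where "D x = (T' x - 1) * w x - (T x - x) * (x / \<sigma>\<^sup>2 * w x)" for x
  have dw: "(w has_real_derivative - (x / \<sigma>\<^sup>2 * w x)) (at x)" for x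
    unfolding w_def[abs_def] using s
    by (auto intro!: derivative_eq_intros simp: field_simps)
  \<comment> \<open>\<open>D\<close> is the derivative of \<open>(T x - x) * w x\<close>.
    Differentiability of \<open>T\<close> is known only inside the interval, so the fundamental
    theorem is used in the version that asks for mere continuity at the end points.\<close>
  have "(D has_integral ((T r - r) * w r - (T l - l) * w l)) {l..r}"
  proof (rule fundamental_theorem_of_calculus_interior)
    fix x assume x: "x \<in> {l<..<r}"
    have "((\<lambda>x. (T x - x) * w x) has_real_derivative D x) (at x)"
      using dT[OF x, folded T'_def] dw[of x]
      by (auto intro!: derivative_eq_intros simp: D_def algebra_simps diff_divide_distrib)
    then show "((\<lambda>x. (T x - x) * w x) has_vector_derivative D x) (at x)"
      by (simp add: has_real_derivative_iff_has_vector_derivative)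
  qed (use lr in \<open>auto intro!: continuous_intros T contw\<close>)
  then have D: "(D has_integral 0) {l..r}" by (simp add: T)
  have bound: "ln (Z / m) * w x \<le> f x * w x + D x" if x: "x \<in> {l..r}" for x
  proof -
    have Tx: "T x \<in> {l..r}" using T(4) x by blast
    have T'_pos: "T' x > 0" using m Z w_pos by (simp add: T'_def)
    have "T' x = (Z / m) * exp ((T x)\<^sup>2 / (2 * \<sigma>\<^sup>2) - x\<^sup>2 / (2 * \<sigma>\<^sup>2) - g (T x))"
      by (simp add: T'_def w_def exp_diff exp_minus exp_add field_simps)
    then have "ln (T' x) = ln (Z / m) + ((T x)\<^sup>2 / (2 * \<sigma>\<^sup>2) - x\<^sup>2 / (2 * \<sigma>\<^sup>2) - g (T x))"
      using m Z by (simp add: ln_mult ln_div)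
    then have "ln (Z / m) \<le> T' x - 1 - (T x)\<^sup>2 / (2 * \<sigma>\<^sup>2) + x\<^sup>2 / (2 * \<sigma>\<^sup>2) + g (T x)"
      using ln_le_minus_one[OF T'_pos] by simp
    also have "\<dots> \<le> T' x - 1 - (T x)\<^sup>2 / (2 * \<sigma>\<^sup>2) + x\<^sup>2 / (2 * \<sigma>\<^sup>2)
        + (f x + (T x - x)\<^sup>2 / (2 * \<sigma>\<^sup>2))"
      using le[OF Tx x] by simp
    \<comment> \<open>The hypothesis has just been used at the pair \<open>T x\<close>,
      \<open>x\<close>. The squares of \<open>T x\<close> cancel, and what remains, multiplied by
      \<open>w x\<close>, is exactly \<open>f x * w x + D x\<close>.\<close>
    also have "\<dots> = f x + (T' x - 1 - (T x - x) * (x / \<sigma>\<^sup>2))"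
      using s by (simp add: field_simps power2_eq_square)
    finally have "ln (Z / m) * w x \<le> (f x + (T' x - 1 - (T x - x) * (x / \<sigma>\<^sup>2))) * w x"
      using w_pos[of x] by (intro mult_right_mono) auto
    then show ?thesis by (simp add: D_def algebra_simps)
  qed
  have "((\<lambda>x. ln (Z / m) * w x) has_integral ln (Z / m) * m) {l..r}"
    unfolding m_def
    by (intro has_integral_mult_right integrable_integral integrable_continuous_interval contw)
  from has_integral_le[OF this has_integral_add[OF integrable_integral[OF f] D] bound]
  have "ln (Z / m) \<le> integral {l..r} (\<lambda>x. f x * w x) / m"
    using m by (simp add: field_simps)
  then have "Z / m \<le> exp (integral {l..r} (\<lambda>x. f x * w x) / m)"
    using m Z by (metis divide_pos_pos exp_le_cancel_iff exp_ln)
  then show ?thesis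
    using m by (simp add: field_simps m_def Z_def)
qed

section \<open>The Gaussian measure on the line and its finite products\<close>

abbreviation gauss :: "real \<Rightarrow> real measure" where
  "gauss \<sigma> \<equiv> density lborel (\<lambda>x. ennreal (normal_density 0 \<sigma> x))"

text \<open>The line is exhausted by compact intervals, on which the inequality is known with the
  restricted Gaussian normalized by its mass. Boundedness by \<open>C\<close> supplies the
  dominating functions for the limit.\<close>

lemma gauss_infimum_convolution:
  fixes f g :: "real \<Rightarrow> real"
  assumes s: "\<sigma> > 0"
    and g: "continuous_on UNIV g" "\<And>x. \<bar>g x\<bar> \<le> C"
    and f: "f \<in> borel_measurable borel" "\<And>x. \<bar>f x\<bar> \<le> C"
    and le: "\<And>x y. g x \<le> f y + (x - y)\<^sup>2 / (2 * \<sigma>\<^sup>2)"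
  shows "(\<integral>x. exp (g x) \<partial>gauss \<sigma>) \<le> exp (\<integral>x. f x \<partial>gauss \<sigma>)"
proof -
  interpret prob_space "gauss \<sigma>" using s by (rule prob_space_normal_density)
  define w where "w x = exp (- (x\<^sup>2) / (2 * \<sigma>\<^sup>2))" for x :: real
  define c where "c = 1 / sqrt (2 * pi * \<sigma>\<^sup>2)"
  have c: "c > 0" using s by (simp add: c_def)
  have nd: "normal_density 0 \<sigma> x = c * w x" for x
    by (simp add: normal_density_def c_def w_def)
  have [measurable]: "w \<in> borel_measurable borel"
    unfolding w_def[abs_def] by measurable
  have w_int: "integrable lborel w"
    using integrable_normal_density[OF s, of 0] c by (simp add: nd[abs_def])
  \<comment> \<open>\<open>J h k\<close> is the Gaussian integral of \<open>h\<close> over a growing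
    window. \<open>Suc k\<close> keeps the window nondegenerate at \<open>k = 0\<close>, as the
    interval inequality requires.\<close>
  define J where "J h k = (\<integral>x. indicator {- real (Suc k)..real (Suc k)} x * h x \<partial>gauss \<sigma>)"
    for h :: "real \<Rightarrow> real" and k
  have J: "(\<lambda>x. h x * w x) integrable_on {- real (Suc k)..real (Suc k)}"
      "J h k = c * integral {- real (Suc k)..real (Suc k)} (\<lambda>x. h x * w x)"
    if [measurable]: "h \<in> borel_measurable borel" and h: "\<And>x. \<bar>h x\<bar> \<le> D" for h k D
  proof -
    have "integrable lborel (\<lambda>x. h x * w x)"
    proof (rule Bochner_Integration.integrable_bound[OF integrable_mult_right[OF w_int, of D]])
      show "AE x in lborel. norm (h x * w x) \<le> norm (D * w x)"
        using order_trans[OF h abs_ge_self] by (intro AE_I2) (auto simp: abs_mult intro!: mult_right_mono)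
    qed measurable
    then have si: "set_integrable lborel {- real (Suc k)..real (Suc k)} (\<lambda>x. h x * w x)"
      unfolding set_integrable_def by (intro integrable_mult_indicator) auto
    show "(\<lambda>x. h x * w x) integrable_on {- real (Suc k)..real (Suc k)}"
      using set_borel_integral_eq_integral(1)[OF si] .
    have "J h k = (\<integral>x. normal_density 0 \<sigma> x *\<^sub>R (indicator {- real (Suc k)..real (Suc k)} x * h x) \<partial>lborel)"
      unfolding J_def using s by (intro integral_density) (auto intro!: AE_I2)
    also have "\<dots> = c * (LINT x:{- real (Suc k)..real (Suc k)}|lborel. h x * w x)"
      unfolding set_lebesgue_integral_def
      by (subst integral_mult_right_zero[symmetric]) (simp add: nd mult_ac)
    finally show "J h k = c * integral {- real (Suc k)..real (Suc k)} (\<lambda>x. h x * w x)"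
      unfolding set_borel_integral_eq_integral(2)[OF si] .
  qed
  have lim: "J h \<longlonglongrightarrow> (\<integral>x. h x \<partial>gauss \<sigma>)"
    if [measurable]: "h \<in> borel_measurable borel" and h: "\<And>x. \<bar>h x\<bar> \<le> D" for h D
    unfolding J_def
  proof (rule integral_dominated_convergence)
    show "AE x in gauss \<sigma>. (\<lambda>k. indicator {- real (Suc k)..real (Suc k)} x * h x) \<longlonglongrightarrow> h x"
    proof (rule AE_I2, rule tendsto_eventually)
      fix x :: real
      obtain N where "\<bar>x\<bar> \<le> real N" using real_arch_simple by blast
      then show "\<forall>\<^sub>F k in sequentially. indicator {- real (Suc k)..real (Suc k)} x * h x = h x"
        by (intro eventually_sequentiallyI[of N]) (auto simp: indicator_def)
    qed
    show "AE x in gauss \<sigma>. norm (indicator {- real (Suc k)..real (Suc k)} x * h x) \<le> D" for k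
      using h order_trans[OF abs_ge_zero h] by (auto simp: indicator_def)
  qed (auto simp: that)
  have g_meas: "g \<in> borel_measurable borel"
    using g(1) by (rule borel_measurable_continuous_onI)
  have exp_g: "(\<lambda>x. exp (g x)) \<in> borel_measurable borel" "\<And>x. \<bar>exp (g x)\<bar> \<le> exp C"
    using g_meas g(2) by (auto intro: order_trans[OF abs_ge_self])
  have one: "(\<lambda>x::real. 1::real) \<in> borel_measurable borel" "\<And>x::real. \<bar>1::real\<bar> \<le> 1" by auto
  \<comment> \<open>The interval inequality times \<open>c\<close>: the constant cancels in the
    quotient in the exponent, and in front it turns the mass of \<open>w\<close> into a Gaussian
    mass, which tends to 1.\<close>
  have "J (\<lambda>x. exp (g x)) k \<le> J (\<lambda>x. 1) k * exp (J f k / J (\<lambda>x. 1) k)" for k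
    unfolding J(2)[OF exp_g] J(2)[OF f] J(2)[OF one]
    using interval_infimum_convolution[of "- real (Suc k)" "real (Suc k)" \<sigma> w g f,
        OF _ s w_def continuous_on_subset[OF g(1)] J(1)[OF f] le] c
    by (simp add: mult.assoc)
  moreover have "(\<lambda>k. J (\<lambda>x. 1) k * exp (J f k / J (\<lambda>x. 1) k)) \<longlonglongrightarrow> 1 * exp ((\<integral>x. f x \<partial>gauss \<sigma>) / 1)"
    using lim[OF f] lim[OF one] prob_space by (intro tendsto_intros) auto
  ultimately show ?thesis
    using lim[OF exp_g] by (intro LIMSEQ_le) auto
qed

text \<open>Integrating out one coordinate turns the pair \<open>g\<close>, \<open>f\<close> into
  \<open>ln E\<close>, \<open>F\<close>, which satisfies the same hypotheses on the remaining
  coordinates, so induction applies. The coordinatewise Lipschitz bound survives this passage and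
  makes the sections of \<open>g\<close> continuous, as the one-dimensional inequality requires.
  Points range over \<open>extensional I\<close> because this is the carrier of the product
  measure.\<close>

lemma product_gauss_infimum_convolution:
  fixes f g :: "('i \<Rightarrow> real) \<Rightarrow> real"
  assumes I: "finite I" and s: "\<sigma> > 0" and K: "K \<ge> 0"
    and g: "g \<in> borel_measurable (PiM I (\<lambda>_. gauss \<sigma>))" "\<And>x. x \<in> extensional I \<Longrightarrow> \<bar>g x\<bar> \<le> C"
      "\<And>x i t. x \<in> extensional I \<Longrightarrow> i \<in> I \<Longrightarrow> g x \<le> g (x(i := t)) + K * \<bar>x i - t\<bar>"
    and f: "f \<in> borel_measurable (PiM I (\<lambda>_. gauss \<sigma>))" "\<And>x. x \<in> extensional I \<Longrightarrow> \<bar>f x\<bar> \<le> C"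
    and le: "\<And>x y. x \<in> extensional I \<Longrightarrow> y \<in> extensional I \<Longrightarrow>
      g x \<le> f y + (\<Sum>i\<in>I. (x i - y i)\<^sup>2) / (2 * \<sigma>\<^sup>2)"
  shows "(\<integral>x. exp (g x) \<partial>PiM I (\<lambda>_. gauss \<sigma>)) \<le> exp (\<integral>x. f x \<partial>PiM I (\<lambda>_. gauss \<sigma>))"
  using I g f le
proof (induction I arbitrary: f g)
  case empty
  then show ?case
    by (simp add: PiM_empty lebesgue_integral_count_space_finite)
next
  case (insert i I)
  note g = insert.prems(1-3) and f = insert.prems(4,5) and le = insert.prems(6)
  note [measurable] = g(1) f(1)
  note fun_upd_apply [simp del]
  interpret G: prob_space "gauss \<sigma>" using s by (rule prob_space_normal_density)
  interpret product_prob_space "\<lambda>_::'i. gauss \<sigma>" by unfold_locales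
  interpret P': prob_space "PiM (insert i I) (\<lambda>_. gauss \<sigma>)" by (rule prob_space_PiM) unfold_locales
  have space_P [simp]: "space (PiM J (\<lambda>_. gauss \<sigma>)) = extensional J" for J :: "'i set"
    by (simp add: space_PiM PiE_def)
  have upd: "x(i := t) \<in> extensional (insert i I)" if "x \<in> extensional I" for x and t :: real
    using that by (auto simp: extensional_def fun_upd_apply)
  have g_bound: "\<bar>g (x(i := t))\<bar> \<le> C" and f_bound: "\<bar>f (x(i := t))\<bar> \<le> C"
    if "x \<in> extensional I" for x t
    by (rule g(2)[OF upd[OF that]], rule f(2)[OF upd[OF that]])
  have g_lip: "g (x(i := u)) \<le> g (x(i := u, j := t)) + K * \<bar>x j - t\<bar>"
    if "x \<in> extensional I" "j \<in> I" for x j u t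
  proof -
    have "g (x(i := u)) \<le> g (x(i := u, j := t)) + K * \<bar>(x(i := u)) j - t\<bar>"
      by (rule g(3)[OF upd[OF that(1)] insertI2[OF that(2)]])
    moreover have "j \<noteq> i" using that insert.hyps(2) by auto
    ultimately show ?thesis by (simp add: fun_upd_other)
  qed
  have g_lip_i: "g (x(i := u)) \<le> g (x(i := v)) + K * \<bar>u - v\<bar>"
    if "x \<in> extensional I" for x u v
  proof -
    have "g (x(i := u)) \<le> g (x(i := u, i := v)) + K * \<bar>(x(i := u)) i - v\<bar>"
      by (rule g(3)[OF upd[OF that(1)] insertI1])
    then show ?thesis by (simp add: fun_upd_same)
  qed
  have sec: "(\<lambda>t. h (x(i := t))) \<in> borel_measurable borel"
    if "x \<in> extensional I" "h \<in> borel_measurable (PiM (insert i I) (\<lambda>_. gauss \<sigma>))"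
    for x and h :: "('i \<Rightarrow> real) \<Rightarrow> real"
    using measurable_compose[OF measurable_component_update[of x I "\<lambda>_. gauss \<sigma>" i] that(2)] that(1)
      insert.hyps(2) by simp
  have meas: "(\<lambda>x. \<integral>t. h (x(i := t)) \<partial>gauss \<sigma>) \<in> borel_measurable (PiM I (\<lambda>_. gauss \<sigma>))"
    if "h \<in> borel_measurable (PiM (insert i I) (\<lambda>_. gauss \<sigma>))" for h :: "('i \<Rightarrow> real) \<Rightarrow> real"
    using measurable_compose[OF measurable_add_dim that]
    by (intro G.borel_measurable_lebesgue_integral) (simp add: case_prod_unfold)
  \<comment> \<open>The exponential moment of \<open>g\<close> and the mean of \<open>f\<close> in
    the coordinate \<open>i\<close>, with the other coordinates frozen.\<close>
  define E where "E x = (\<integral>t. exp (g (x(i := t))) \<partial>gauss \<sigma>)" for x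
  define F where "F x = (\<integral>t. f (x(i := t)) \<partial>gauss \<sigma>)" for x
  have int_eg: "integrable (gauss \<sigma>) (\<lambda>t. exp (g (x(i := t))))" if x: "x \<in> extensional I" for x
  proof (rule G.integrable_const_bound[of _ "exp C"])
    have "g (x(i := t)) \<le> C" for t using g_bound[OF x, of t] by simp
    then show "AE t in gauss \<sigma>. norm (exp (g (x(i := t)))) \<le> exp C" by simp
    have "(\<lambda>t. exp (g (x(i := t)))) \<in> borel_measurable borel"
      by (rule measurable_compose[OF sec[OF x g(1)] borel_measurable_exp])
    then show "(\<lambda>t. exp (g (x(i := t)))) \<in> borel_measurable (gauss \<sigma>)" by simp
  qed
  have int_f: "integrable (gauss \<sigma>) (\<lambda>t. f (x(i := t)))" if x: "x \<in> extensional I" for x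
  proof (rule G.integrable_const_bound[of _ C])
    show "AE t in gauss \<sigma>. norm (f (x(i := t))) \<le> C"
      using f_bound[OF x] by (intro AE_I2) simp
    have "(\<lambda>t. f (x(i := t))) \<in> borel_measurable borel" by (rule sec[OF x f(1)])
    then show "(\<lambda>t. f (x(i := t))) \<in> borel_measurable (gauss \<sigma>)" by simp
  qed
  have E_bounds: "exp (- C) \<le> E x" "E x \<le> exp C" if x: "x \<in> extensional I" for x
  proof -
    have "- C \<le> g (x(i := t)) \<and> g (x(i := t)) \<le> C" for t using g(2)[OF upd[OF x], of t] by auto
    then show "exp (- C) \<le> E x" "E x \<le> exp C"
      unfolding E_def using int_eg[OF x]
      by (auto intro!: G.integral_ge_const G.integral_le_const)
  qed
  have E_pos: "E x > 0" if "x \<in> extensional I" for x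
    using E_bounds(1)[OF that] exp_gt_zero[of "- C"] by linarith
  have F_bound: "\<bar>F x\<bar> \<le> C" if x: "x \<in> extensional I" for x
  proof -
    have "- C \<le> f (x(i := t)) \<and> f (x(i := t)) \<le> C" for t using f(2)[OF upd[OF x], of t] by auto
    then have "- C \<le> F x" "F x \<le> C"
      unfolding F_def using int_f[OF x]
      by (auto intro!: G.integral_ge_const G.integral_le_const)
    then show ?thesis by auto
  qed
  have "(\<integral>x. exp (ln (E x)) \<partial>PiM I (\<lambda>_. gauss \<sigma>)) \<le> exp (\<integral>x. F x \<partial>PiM I (\<lambda>_. gauss \<sigma>))"
  proof (rule insert.IH)
    show "(\<lambda>x. ln (E x)) \<in> borel_measurable (PiM I (\<lambda>_. gauss \<sigma>))"
      "F \<in> borel_measurable (PiM I (\<lambda>_. gauss \<sigma>))"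
      unfolding E_def[abs_def] F_def[abs_def] using meas[OF f(1)] meas[of "\<lambda>x. exp (g x)"] by auto
    show "\<bar>F x\<bar> \<le> C" if "x \<in> extensional I" for x using F_bound that .
    show "\<bar>ln (E x)\<bar> \<le> C" if "x \<in> extensional I" for x
      using E_bounds[OF that] E_pos[OF that] ln_le_cancel_iff[of "exp (- C)" "E x"]
        ln_le_cancel_iff[of "E x" "exp C"] by auto
    \<comment> \<open>A constant added to \<open>g\<close> multiplies \<open>E\<close> by its
      exponential, so the logarithm returns the same Lipschitz constant \<open>K\<close>.\<close>
    show "ln (E x) \<le> ln (E (x(j := t))) + K * \<bar>x j - t\<bar>"
      if x: "x \<in> extensional I" and j: "j \<in> I" for x j t
    proof -
      have x': "x(j := t) \<in> extensional I" using x j by (auto simp: extensional_def fun_upd_apply)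
      have ij: "j \<noteq> i" using j insert.hyps(2) by auto
      have "E x \<le> (\<integral>u. exp (K * \<bar>x j - t\<bar>) * exp (g ((x(j := t))(i := u))) \<partial>gauss \<sigma>)"
        unfolding E_def
      proof (rule integral_mono)
        fix u
        show "exp (g (x(i := u))) \<le> exp (K * \<bar>x j - t\<bar>) * exp (g ((x(j := t))(i := u)))"
          using g_lip[OF x, of j u t] j ij
          by (simp add: mult_exp_exp fun_upd_twist[OF ij] add.commute)
      qed (use int_eg[OF x] int_eg[OF x'] in auto)
      also have "\<dots> = exp (K * \<bar>x j - t\<bar>) * E (x(j := t))" by (simp add: E_def)
      finally have "ln (E x) \<le> ln (exp (K * \<bar>x j - t\<bar>) * E (x(j := t)))"
        using E_pos[OF x] by (subst ln_le_cancel_iff) (auto intro: mult_pos_pos E_pos[OF x'])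
      then show ?thesis using E_pos[OF x'] by (simp add: ln_mult)
    qed
    show "ln (E x) \<le> F y + (\<Sum>j\<in>I. (x j - y j)\<^sup>2) / (2 * \<sigma>\<^sup>2)"
      if x: "x \<in> extensional I" and y: "y \<in> extensional I" for x y
    proof -
      \<comment> \<open>With \<open>x\<close> and \<open>y\<close> frozen, \<open>S\<close> is the
        quadratic cost of the coordinates in \<open>I\<close>. Adding it to the section of
        \<open>f\<close> leaves only the one-dimensional cost of moving \<open>v\<close> to
        \<open>u\<close>.\<close>
      define S where "S = (\<Sum>j\<in>I. (x j - y j)\<^sup>2) / (2 * \<sigma>\<^sup>2)"
      have "E x \<le> exp (\<integral>t. f (y(i := t)) + S \<partial>gauss \<sigma>)"
        unfolding E_def
      proof (rule gauss_infimum_convolution[OF s, where C = "C + \<bar>S\<bar>"])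
        have "\<bar>g (x(i := u)) - g (x(i := v))\<bar> \<le> K * \<bar>u - v\<bar>" for u v
          using g_lip_i[OF x, of u v] g_lip_i[OF x, of v u]
          by (auto simp: abs_le_iff abs_minus_commute)
        then have "K-lipschitz_on UNIV (\<lambda>t. g (x(i := t)))"
          using K by (intro lipschitz_onI) (auto simp: dist_real_def)
        then show "continuous_on UNIV (\<lambda>t. g (x(i := t)))" by (rule lipschitz_on_continuous_on)
        show "\<bar>g (x(i := t))\<bar> \<le> C + \<bar>S\<bar>" for t using g_bound[OF x, of t] by simp
        show "\<bar>f (y(i := t)) + S\<bar> \<le> C + \<bar>S\<bar>" for t using f_bound[OF y, of t] by simp
        show "(\<lambda>t. f (y(i := t)) + S) \<in> borel_measurable borel"
          by (intro borel_measurable_add sec[OF y f(1)] borel_measurable_const)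
        fix u v
        have "(\<Sum>j\<in>insert i I. ((x(i := u)) j - (y(i := v)) j)\<^sup>2)
            = (u - v)\<^sup>2 + (\<Sum>j\<in>I. (x j - y j)\<^sup>2)"
          using insert.hyps by (auto simp: fun_upd_apply intro!: sum.cong)
        then show "g (x(i := u)) \<le> f (y(i := v)) + S + (u - v)\<^sup>2 / (2 * \<sigma>\<^sup>2)"
          using le[OF upd[OF x, of u] upd[OF y, of v]] by (simp add: S_def add_divide_distrib)
      qed
      also have "(\<integral>t. f (y(i := t)) + S \<partial>gauss \<sigma>) = F y + S"
        using int_f[OF y] G.prob_space by (simp add: F_def)
      finally show ?thesis using E_pos[OF x] unfolding S_def by (metis exp_le_cancel_iff exp_ln)
    qed
  qed
  also have "(\<integral>x. exp (ln (E x)) \<partial>PiM I (\<lambda>_. gauss \<sigma>)) = (\<integral>x. E x \<partial>PiM I (\<lambda>_. gauss \<sigma>))"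
    by (rule Bochner_Integration.integral_cong) (auto simp: E_pos)
  also have "\<dots> = (\<integral>x. exp (g x) \<partial>PiM (insert i I) (\<lambda>_. gauss \<sigma>))"
    unfolding E_def
    by (rule product_integral_insert[symmetric, OF insert.hyps(1,2)],
        rule P'.integrable_const_bound[of _ "exp C"])
      (auto intro!: AE_I2 abs_le_D1[OF g(2)])
  also have "(\<integral>x. F x \<partial>PiM I (\<lambda>_. gauss \<sigma>)) = (\<integral>x. f x \<partial>PiM (insert i I) (\<lambda>_. gauss \<sigma>))"
    unfolding F_def
    by (rule product_integral_insert[symmetric, OF insert.hyps(1,2)],
        rule P'.integrable_const_bound[of _ C])
      (use f(2) in auto)
  finally show ?case .
qed

subsection \<open>Concentration of Lipschitz functions\<close>

lemma prod_Basis_cart: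
  "(\<Prod>b\<in>(Basis :: (real ^ 'n) set). h b) = (\<Prod>i\<in>UNIV. h (axis i 1))"
proof -
  have "(Basis :: (real ^ 'n) set) = range (\<lambda>i. axis i 1)"
    by (auto simp: Basis_vec_def)
  then show ?thesis
    using prod.reindex[of "\<lambda>i::'n. axis i (1::real)" UNIV h] by (simp add: inj_def axis_eq_axis o_def)
qed

text \<open>The joint density is a product over the coordinates, so boxes have product
  probabilities, and these determine the product measure.\<close>

lemma distr_isotropic_normal:
  fixes \<xi> :: "'a \<Rightarrow> real ^ 'n"
  assumes s: "\<sigma> > 0" and \<xi>: "isotropic_normal M \<sigma> \<xi>"
  shows "distr M (PiM UNIV (\<lambda>_. gauss \<sigma>)) (\<lambda>\<omega>. ($) (\<xi> \<omega>)) = PiM UNIV (\<lambda>_. gauss \<sigma>)"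
proof -
  interpret G: prob_space "gauss \<sigma>" using s by (rule prob_space_normal_density)
  interpret product_prob_space "\<lambda>_::'n. gauss \<sigma>" UNIV by unfold_locales
  have D: "distributed M lborel \<xi> (\<lambda>v. ennreal (\<Prod>i\<in>UNIV. normal_density 0 \<sigma> (v $ i)))"
    using \<xi> by (simp add: isotropic_normal_def)
  have \<xi>_meas [measurable]: "\<xi> \<in> borel_measurable M"
    using distributed_measurable[OF D] by simp
  have vec_meas [measurable]: "(\<lambda>v::real^'n. v $ i) \<in> borel_measurable borel" for i
    by (intro borel_measurable_continuous_onI continuous_intros)
  have nth_meas: "(\<lambda>\<omega>. ($) (\<xi> \<omega>)) \<in> measurable M (PiM UNIV (\<lambda>_. gauss \<sigma>))"
    by (rule measurable_PiM_single') auto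
  show ?thesis
  proof (rule PiM_eqI)
    fix A :: "'n \<Rightarrow> real set" assume "\<And>i. i \<in> UNIV \<Longrightarrow> A i \<in> sets (gauss \<sigma>)"
    then have A [measurable]: "A i \<in> sets borel" for i by simp
    have "Pi\<^sub>E UNIV A \<in> sets (PiM UNIV (\<lambda>_. gauss \<sigma>))"
      by (rule sets_PiM_I_finite) auto
    then have "emeasure (distr M (PiM UNIV (\<lambda>_. gauss \<sigma>)) (\<lambda>\<omega>. ($) (\<xi> \<omega>))) (Pi\<^sub>E UNIV A)
        = emeasure M (\<xi> -` {v. \<forall>i. v $ i \<in> A i} \<inter> space M)"
      by (subst emeasure_distr[OF nth_meas])
        (auto simp: PiE_UNIV_domain vimage_def intro!: arg_cong[where f = "emeasure M"])
    also have "\<dots> = (\<integral>\<^sup>+v. ennreal (\<Prod>i\<in>UNIV. normal_density 0 \<sigma> (v $ i))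
        * indicator {v. \<forall>i. v $ i \<in> A i} v \<partial>lborel)"
      by (rule distributed_emeasure[OF D]) measurable
    \<comment> \<open>The integral formula for \<open>lborel\<close> factorizes over basis vectors
      rather than indices. \<open>SOME i. b = axis i 1\<close> recovers the index, which is unique
      because distinct indices give distinct axes.\<close>
    also have "\<dots> = (\<integral>\<^sup>+v. (\<Prod>b\<in>Basis. (\<lambda>b t. ennreal (normal_density 0 \<sigma> t)
        * indicator (A (SOME i. b = axis i 1)) t) b (v \<bullet> b)) \<partial>(lborel :: (real^'n) measure))"
      by (intro nn_integral_cong)
        (auto simp: prod_Basis_cart axis_eq_axis inner_axis prod.distrib prod_ennreal indicator_def)
    also have "\<dots> = (\<Prod>b\<in>(Basis :: (real^'n) set). \<integral>\<^sup>+t. ennreal (normal_density 0 \<sigma> t)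
        * indicator (A (SOME i. b = axis i 1)) t \<partial>lborel)"
      by (rule nn_integral_lborel_prod) auto
    also have "\<dots> = (\<Prod>i\<in>UNIV. emeasure (gauss \<sigma>) (A i))"
      by (simp add: prod_Basis_cart axis_eq_axis emeasure_density)
    finally show "emeasure (distr M (PiM UNIV (\<lambda>_. gauss \<sigma>)) (\<lambda>\<omega>. ($) (\<xi> \<omega>))) (Pi\<^sub>E UNIV A)
        = (\<Prod>i\<in>UNIV. emeasure (gauss \<sigma>) (A i))" .
  qed auto
qed

text \<open>The product inequality is applied to \<open>H\<close> and \<open>H - S\<close>. Its
  hypothesis reduces to Young's inequality \<open>L * d <= S + d^2 / (2 * \<sigma>^2)\<close>, and
  \<open>S\<close> is the least constant for which this holds for every distance
  \<open>d\<close>.\<close>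

lemma isotropic_normal_bounded_mgf:
  fixes \<xi> :: "'a \<Rightarrow> real ^ 'n" and h :: "real ^ 'n \<Rightarrow> real"
  assumes s: "\<sigma> > 0" and \<xi>: "isotropic_normal M \<sigma> \<xi>"
    and h: "L-lipschitz_on UNIV h" "\<And>v. \<bar>h v\<bar> \<le> C"
  shows "(\<integral>\<omega>. exp (h (\<xi> \<omega>)) \<partial>M) \<le> exp ((\<integral>\<omega>. h (\<xi> \<omega>) \<partial>M) + L\<^sup>2 * \<sigma>\<^sup>2 / 2)"
proof -
  let ?P = "PiM (UNIV :: 'n set) (\<lambda>_. gauss \<sigma>)"
  define S where "S = L\<^sup>2 * \<sigma>\<^sup>2 / 2"
  interpret G: prob_space "gauss \<sigma>" using s by (rule prob_space_normal_density)
  interpret P: prob_space ?P by (rule prob_space_PiM) unfold_locales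
  have L: "L \<ge> 0" using h(1) by (rule lipschitz_on_nonneg)
  have lip: "h u \<le> h v + L * norm (u - v)" for u v
    using lipschitz_onD[OF h(1), of u v] by (auto simp: dist_real_def dist_norm abs_le_iff)
  have [measurable]: "h \<in> borel_measurable borel"
    using lipschitz_on_continuous_on[OF h(1)] by (rule borel_measurable_continuous_onI)
  have vec_meas [measurable]: "(\<lambda>v::real^'n. v $ i) \<in> borel_measurable borel" for i
    by (intro borel_measurable_continuous_onI continuous_intros)
  have \<xi>_meas [measurable]: "\<xi> \<in> borel_measurable M"
    using \<xi> distributed_measurable by (force simp: isotropic_normal_def)
  have nth_meas: "(\<lambda>\<omega>. ($) (\<xi> \<omega>)) \<in> measurable M ?P"
    by (rule measurable_PiM_single') auto
  have lambda_meas [measurable]: "(\<lambda>x. (\<chi> i. x i)) \<in> measurable ?P (borel :: (real^'n) measure)"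
    by (subst borel_measurable_euclidean_space) (auto simp: Basis_vec_def inner_axis)
  define H where "H x = h (\<chi> i. x i)" for x
  have H [measurable]: "H \<in> borel_measurable ?P"
    unfolding H_def[abs_def] by measurable
  have transfer: "(\<integral>x. k (H x) \<partial>?P) = (\<integral>\<omega>. k (h (\<xi> \<omega>)) \<partial>M)"
    if [measurable]: "k \<in> borel_measurable borel" for k :: "real \<Rightarrow> real"
    by (subst distr_isotropic_normal[OF s \<xi>, symmetric], subst integral_distr[OF nth_meas])
      (simp_all add: H_def vec_nth_inverse)
  have "(\<integral>x. exp (H x - S) \<partial>?P) \<le> exp (\<integral>x. H x \<partial>?P)"
  proof (rule product_gauss_infimum_convolution[OF _ s L, where C = "C + \<bar>S\<bar>"])
    show "\<bar>H x - S\<bar> \<le> C + \<bar>S\<bar>" for x using h(2)[of "\<chi> i. x i"] by (simp add: H_def)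
    show "\<bar>H x\<bar> \<le> C + \<bar>S\<bar>" for x using h(2)[of "\<chi> i. x i"] by (simp add: H_def)
    show "H x - S \<le> H (x(i := t)) - S + L * \<bar>x i - t\<bar>" for x i t
    proof -
      have "norm ((\<chi> j. x j) - (\<chi> j. (x(i := t)) j)) \<le> (\<Sum>j\<in>UNIV. if j = i then \<bar>x i - t\<bar> else 0)"
        by (rule order_trans[OF norm_le_l1_cart sum_mono]) auto
      then have "L * norm ((\<chi> j. x j) - (\<chi> j. (x(i := t)) j)) \<le> L * \<bar>x i - t\<bar>"
        using L by (intro mult_left_mono) auto
      then show ?thesis
        using lip[of "\<chi> j. x j" "\<chi> j. (x(i := t)) j"] unfolding H_def by linarith
    qed
    show "H x - S \<le> H y + (\<Sum>i\<in>UNIV. (x i - y i)\<^sup>2) / (2 * \<sigma>\<^sup>2)" for x y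
    proof -
      define d where "d = norm ((\<chi> i. x i) - (\<chi> i. y i) :: real^'n)"
      have "d\<^sup>2 = (\<Sum>i\<in>UNIV. (x i - y i)\<^sup>2)"
        by (simp add: d_def norm_vec_def L2_set_def sum_nonneg)
      moreover have "L * d \<le> S + d\<^sup>2 / (2 * \<sigma>\<^sup>2)"
      proof -
        have "0 \<le> (L * \<sigma> - d / \<sigma>)\<^sup>2 / 2" by simp
        also have "\<dots> = S + d\<^sup>2 / (2 * \<sigma>\<^sup>2) - L * d"
          using s by (simp add: S_def power2_eq_square field_simps)
        finally show ?thesis by simp
      qed
      ultimately show ?thesis
        using lip[of "\<chi> i. x i" "\<chi> i. y i"] by (simp add: H_def d_def[symmetric])
    qed
  qed auto
  then have "(\<integral>x. exp (H x) \<partial>?P) \<le> exp S * exp (\<integral>x. H x \<partial>?P)"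
    by (simp add: exp_diff field_simps)
  then show ?thesis
    unfolding transfer[OF borel_measurable_exp] transfer[of "\<lambda>x. x", simplified]
    by (simp add: S_def exp_add mult.commute)
qed

section \<open>Unbounded Lipschitz functions by truncation\<close>

lemma lipschitz_clamp:
  fixes h :: "'b::metric_space \<Rightarrow> real"
  assumes "L-lipschitz_on U h"
  shows "L-lipschitz_on U (\<lambda>v. max (- c) (min c (h v)))"
proof (rule lipschitz_onI)
  fix x y assume "x \<in> U" "y \<in> U"
  then show "dist (max (- c) (min c (h x))) (max (- c) (min c (h y))) \<le> L * dist x y"
    using lipschitz_onD[OF assms, of x y] by (auto simp: dist_real_def)
qed (rule lipschitz_on_nonneg[OF assms])

text \<open>The bound on the Laplace transform of the truncations of \<open>-\<bar>h\<bar>\<close> already yields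
  integrability of \<open>h\<close>: a divergent mean would force \<open>E exp (-\<bar>h\<bar>) = 0\<close>.\<close>

lemma isotropic_normal_lipschitz_integrable:
  fixes \<xi> :: "'a \<Rightarrow> real ^ 'n" and h :: "real ^ 'n \<Rightarrow> real"
  assumes M: "prob_space M" and s: "\<sigma> > 0" and \<xi>: "isotropic_normal M \<sigma> \<xi>"
    and h: "L-lipschitz_on UNIV h"
  shows "integrable M (\<lambda>\<omega>. h (\<xi> \<omega>))"
proof -
  interpret prob_space M by fact
  have [measurable]: "h \<in> borel_measurable borel"
    using lipschitz_on_continuous_on[OF h] by (rule borel_measurable_continuous_onI)
  have \<xi>_meas [measurable]: "\<xi> \<in> borel_measurable M"
    using \<xi> distributed_measurable by (force simp: isotropic_normal_def)
  have abs_lip: "L-lipschitz_on UNIV (\<lambda>v. - min (real k) \<bar>h v\<bar>)" for k :: nat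
  proof (rule lipschitz_onI)
    show "dist (- min (real k) \<bar>h x\<bar>) (- min (real k) \<bar>h y\<bar>) \<le> L * dist x y" for x y
      using lipschitz_onD[OF h, of x y] by (auto simp: dist_real_def)
  qed (rule lipschitz_on_nonneg[OF h])
  have int_min: "integrable M (\<lambda>\<omega>. min (real k) \<bar>h (\<xi> \<omega>)\<bar>)" for k :: nat
    by (rule integrable_const_bound[of _ "real k"]) auto
  have int_exp: "integrable M (\<lambda>\<omega>. exp (- \<bar>h (\<xi> \<omega>)\<bar>))"
    by (rule integrable_const_bound[of _ 1]) auto
  define e where "e = (\<integral>\<omega>. exp (- \<bar>h (\<xi> \<omega>)\<bar>) \<partial>M)"
  have "e \<noteq> 0"
    unfolding e_def using integral_nonneg_eq_0_iff_AE[OF int_exp] AE_False by simp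
  moreover have "e \<ge> 0"
    unfolding e_def by (rule integral_nonneg_AE) auto
  ultimately have e: "e > 0" by simp
  \<comment> \<open>Truncating the absolute value only raises the exponential of its negative, so
    \<open>e\<close> lies below every truncated Laplace transform. The resulting bound on the
    truncated means is uniform in \<open>k\<close>.\<close>
  have bound: "(\<integral>\<omega>. min (real k) \<bar>h (\<xi> \<omega>)\<bar> \<partial>M) \<le> L\<^sup>2 * \<sigma>\<^sup>2 / 2 - ln e" for k :: nat
  proof -
    have "e \<le> (\<integral>\<omega>. exp (- min (real k) \<bar>h (\<xi> \<omega>)\<bar>) \<partial>M)"
      unfolding e_def
      by (intro integral_mono int_exp integrable_const_bound[of _ 1]) auto
    also have "\<dots> \<le> exp (- (\<integral>\<omega>. min (real k) \<bar>h (\<xi> \<omega>)\<bar> \<partial>M) + L\<^sup>2 * \<sigma>\<^sup>2 / 2)"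
      using isotropic_normal_bounded_mgf[OF s \<xi> abs_lip[of k], of "real k"] by simp
    finally have "ln e \<le> - (\<integral>\<omega>. min (real k) \<bar>h (\<xi> \<omega>)\<bar> \<partial>M) + L\<^sup>2 * \<sigma>\<^sup>2 / 2"
      using e by (metis exp_le_cancel_iff exp_ln)
    then show ?thesis by simp
  qed
  \<comment> \<open>At each point the truncations are eventually equal to the absolute value of
    \<open>h\<close>, so Fatou's lemma carries the uniform bound over to it.\<close>
  have "(\<integral>\<^sup>+\<omega>. ennreal \<bar>h (\<xi> \<omega>)\<bar> \<partial>M)
      = (\<integral>\<^sup>+\<omega>. liminf (\<lambda>k. ennreal (min (real k) \<bar>h (\<xi> \<omega>)\<bar>)) \<partial>M)"
  proof (rule nn_integral_cong)
    fix \<omega>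
    obtain N where "\<bar>h (\<xi> \<omega>)\<bar> \<le> real N" using real_arch_simple by blast
    then have "(\<lambda>k. ennreal (min (real k) \<bar>h (\<xi> \<omega>)\<bar>)) \<longlonglongrightarrow> ennreal \<bar>h (\<xi> \<omega>)\<bar>"
      by (intro tendsto_eventually eventually_sequentiallyI[of N]) (auto simp: min_def)
    then show "ennreal \<bar>h (\<xi> \<omega>)\<bar> = liminf (\<lambda>k. ennreal (min (real k) \<bar>h (\<xi> \<omega>)\<bar>))"
      by (rule lim_imp_Liminf[OF trivial_limit_sequentially, symmetric])
  qed
  also have "\<dots> \<le> liminf (\<lambda>k. \<integral>\<^sup>+\<omega>. ennreal (min (real k) \<bar>h (\<xi> \<omega>)\<bar>) \<partial>M)"
    by (rule nn_integral_liminf) measurable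
  also have "\<dots> \<le> liminf (\<lambda>k::nat. ennreal (L\<^sup>2 * \<sigma>\<^sup>2 / 2 - ln e))"
    using bound
    by (intro Liminf_mono always_eventually allI)
      (subst nn_integral_eq_integral[OF int_min], auto intro: ennreal_leI)
  also have "\<dots> = ennreal (L\<^sup>2 * \<sigma>\<^sup>2 / 2 - ln e)"
    by (simp add: Liminf_const)
  finally have "(\<integral>\<^sup>+\<omega>. ennreal \<bar>h (\<xi> \<omega>)\<bar> \<partial>M) < \<infinity>"
    by (auto simp: le_less_trans)
  then show ?thesis
    by (intro integrableI_bounded) auto
qed

text \<open>Chernoff's method: the Laplace bound passes from truncations of \<open>h\<close> to
  \<open>h\<close> itself, and Markov's inequality is applied at the optimal exponent.\<close>

lemma isotropic_normal_lipschitz_upper_tail: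
  fixes \<xi> :: "'a \<Rightarrow> real ^ 'n" and h :: "real ^ 'n \<Rightarrow> real"
  assumes M: "prob_space M" and s: "\<sigma> > 0" and \<xi>: "isotropic_normal M \<sigma> \<xi>"
    and h: "L-lipschitz_on UNIV h" and L: "L > 0" and t: "t \<ge> 0"
  shows "measure M {\<omega> \<in> space M. h (\<xi> \<omega>) \<le> (\<integral>\<omega>. h (\<xi> \<omega>) \<partial>M) + t}
    \<ge> 1 - exp (- (t\<^sup>2 / (2 * L\<^sup>2 * \<sigma>\<^sup>2)))"
proof -
  interpret prob_space M by fact
  have [measurable]: "h \<in> borel_measurable borel"
    using lipschitz_on_continuous_on[OF h] by (rule borel_measurable_continuous_onI)
  have \<xi>_meas [measurable]: "\<xi> \<in> borel_measurable M"
    using \<xi> distributed_measurable by (force simp: isotropic_normal_def)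
  define m where "m = (\<integral>\<omega>. h (\<xi> \<omega>) \<partial>M)"
  \<comment> \<open>\<open>l\<close> minimizes \<open>l^2 * L^2 * \<sigma>^2 / 2 - l * t\<close>,
    the exponent that Markov's inequality produces below; the minimum is
    \<open>- (t^2 / (2 * L^2 * \<sigma>^2))\<close>.\<close>
  define l where "l = t / (L\<^sup>2 * \<sigma>\<^sup>2)"
  have l: "l \<ge> 0" using t by (simp add: l_def)
  define c where "c k v = max (- real k) (min (real k) (h v))" for k v
  have c_bound: "\<bar>c k v\<bar> \<le> real k" for k v by (auto simp: c_def)
  have [measurable]: "c k \<in> borel_measurable borel" for k
    unfolding c_def[abs_def] by measurable
  have c_lim: "(\<lambda>k. c k v) \<longlonglongrightarrow> h v" for v
  proof -
    obtain N where "\<bar>h v\<bar> \<le> real N" using real_arch_simple by blast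
    then show ?thesis
      by (intro tendsto_eventually eventually_sequentiallyI[of N]) (auto simp: c_def)
  qed
  \<comment> \<open>The Laplace bound for a truncation contains the mean of that truncation, so
    these means must converge to \<open>m\<close>. Integrability of \<open>h\<close> provides the
    dominating function.\<close>
  have "(\<lambda>k. \<integral>\<omega>. c k (\<xi> \<omega>) \<partial>M) \<longlonglongrightarrow> m"
    unfolding m_def
  proof (rule integral_dominated_convergence)
    show "integrable M (\<lambda>\<omega>. \<bar>h (\<xi> \<omega>)\<bar>)"
      using isotropic_normal_lipschitz_integrable[OF M s \<xi> h] by simp
    show "AE \<omega> in M. norm (c k (\<xi> \<omega>)) \<le> \<bar>h (\<xi> \<omega>)\<bar>" for k
      by (auto simp: c_def)
  qed (auto simp: c_lim)
  then have lim: "(\<lambda>k. ennreal (exp (l * (\<integral>\<omega>. c k (\<xi> \<omega>) \<partial>M) + (l * L)\<^sup>2 * \<sigma>\<^sup>2 / 2)))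
      \<longlonglongrightarrow> ennreal (exp (l * m + (l * L)\<^sup>2 * \<sigma>\<^sup>2 / 2))"
    by (intro tendsto_ennrealI tendsto_intros)
  have mgf: "(\<integral>\<^sup>+\<omega>. ennreal (exp (l * c k (\<xi> \<omega>))) \<partial>M)
      \<le> ennreal (exp (l * (\<integral>\<omega>. c k (\<xi> \<omega>) \<partial>M) + (l * L)\<^sup>2 * \<sigma>\<^sup>2 / 2))" for k
  proof (subst nn_integral_eq_integral)
    show "integrable M (\<lambda>\<omega>. exp (l * c k (\<xi> \<omega>)))"
    proof (rule integrable_const_bound[of _ "exp (l * real k)"])
      have "c k v \<le> real k" for v using c_bound[of k v] by auto
      then show "AE \<omega> in M. norm (exp (l * c k (\<xi> \<omega>))) \<le> exp (l * real k)"
        using l by (auto intro: mult_left_mono)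
    qed measurable
    have "(l * L)-lipschitz_on UNIV (\<lambda>v. l * c k v)"
      using lipschitz_on_cmult_real[OF lipschitz_clamp[OF h, of "real k"], of l] l by (simp add: c_def)
    from isotropic_normal_bounded_mgf[OF s \<xi> this, of "l * real k"]
    show "ennreal (\<integral>\<omega>. exp (l * c k (\<xi> \<omega>)) \<partial>M)
      \<le> ennreal (exp (l * (\<integral>\<omega>. c k (\<xi> \<omega>) \<partial>M) + (l * L)\<^sup>2 * \<sigma>\<^sup>2 / 2))"
      using l c_bound by (auto simp: abs_mult intro!: ennreal_leI mult_left_mono)
  qed auto
  \<comment> \<open>Working with nonnegative integrals, Fatou's lemma gives at once the bound and
    the finiteness of the exponential moment of \<open>h\<close>.\<close>
  have "(\<integral>\<^sup>+\<omega>. ennreal (exp (l * h (\<xi> \<omega>))) \<partial>M)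
      = (\<integral>\<^sup>+\<omega>. liminf (\<lambda>k. ennreal (exp (l * c k (\<xi> \<omega>)))) \<partial>M)"
  proof (rule nn_integral_cong)
    fix \<omega>
    have "(\<lambda>k. ennreal (exp (l * c k (\<xi> \<omega>)))) \<longlonglongrightarrow> ennreal (exp (l * h (\<xi> \<omega>)))"
      by (intro tendsto_ennrealI tendsto_intros c_lim)
    then show "ennreal (exp (l * h (\<xi> \<omega>))) = liminf (\<lambda>k. ennreal (exp (l * c k (\<xi> \<omega>))))"
      by (rule lim_imp_Liminf[OF trivial_limit_sequentially, symmetric])
  qed
  also have "\<dots> \<le> liminf (\<lambda>k. \<integral>\<^sup>+\<omega>. ennreal (exp (l * c k (\<xi> \<omega>))) \<partial>M)"
    by (rule nn_integral_liminf) measurable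
  also have "\<dots> \<le> liminf (\<lambda>k. ennreal (exp (l * (\<integral>\<omega>. c k (\<xi> \<omega>) \<partial>M) + (l * L)\<^sup>2 * \<sigma>\<^sup>2 / 2)))"
    using mgf by (intro Liminf_mono always_eventually allI) auto
  also have "\<dots> = ennreal (exp (l * m + (l * L)\<^sup>2 * \<sigma>\<^sup>2 / 2))"
    by (rule lim_imp_Liminf[OF trivial_limit_sequentially lim])
  finally have mgf_h: "(\<integral>\<^sup>+\<omega>. ennreal (exp (l * h (\<xi> \<omega>))) \<partial>M)
      \<le> ennreal (exp (l * m + (l * L)\<^sup>2 * \<sigma>\<^sup>2 / 2))" .
  \<comment> \<open>Markov's inequality is prepared with threshold 1. For \<open>t = 0\<close> also
    \<open>l = 0\<close>; the larger event is then the whole space and the final bound is 1.\<close>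
  have "emeasure M {\<omega> \<in> space M. m + t < h (\<xi> \<omega>)}
      \<le> emeasure M {\<omega> \<in> space M. 1 \<le> ennreal (exp (- (l * (m + t)))) * ennreal (exp (l * h (\<xi> \<omega>)))}"
  proof (intro emeasure_mono subsetI CollectI conjI)
    fix \<omega> assume \<omega>: "\<omega> \<in> {\<omega> \<in> space M. m + t < h (\<xi> \<omega>)}"
    then have "l * (m + t) \<le> l * h (\<xi> \<omega>)" using l by (intro mult_left_mono) auto
    then show "1 \<le> ennreal (exp (- (l * (m + t)))) * ennreal (exp (l * h (\<xi> \<omega>)))"
      by (auto simp: ennreal_mult[symmetric] mult_exp_exp simp flip: ennreal_1 intro!: ennreal_leI)
  qed auto
  also have "\<dots> \<le> ennreal (exp (- (l * (m + t))))
      * (\<integral>\<^sup>+\<omega>. ennreal (exp (l * h (\<xi> \<omega>))) * indicator (space M) \<omega> \<partial>M)"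
    by (rule nn_integral_Markov_inequality) auto
  also have "(\<integral>\<^sup>+\<omega>. ennreal (exp (l * h (\<xi> \<omega>))) * indicator (space M) \<omega> \<partial>M)
      = (\<integral>\<^sup>+\<omega>. ennreal (exp (l * h (\<xi> \<omega>))) \<partial>M)"
    by (rule nn_integral_cong) simp
  also have "ennreal (exp (- (l * (m + t)))) * \<dots>
      \<le> ennreal (exp (- (l * (m + t)))) * ennreal (exp (l * m + (l * L)\<^sup>2 * \<sigma>\<^sup>2 / 2))"
    by (intro mult_left_mono mgf_h) auto
  also have "\<dots> = ennreal (exp (- (t\<^sup>2 / (2 * L\<^sup>2 * \<sigma>\<^sup>2))))"
  proof -
    have "- (l * (m + t)) + (l * m + (l * L)\<^sup>2 * \<sigma>\<^sup>2 / 2) = - (t\<^sup>2 / (2 * L\<^sup>2 * \<sigma>\<^sup>2))"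
      using s L by (simp add: l_def power2_eq_square field_simps)
    then show ?thesis by (simp add: ennreal_mult[symmetric] mult_exp_exp)
  qed
  finally have "prob {\<omega> \<in> space M. m + t < h (\<xi> \<omega>)} \<le> exp (- (t\<^sup>2 / (2 * L\<^sup>2 * \<sigma>\<^sup>2)))"
    by (simp add: emeasure_eq_measure)
  moreover have "prob {\<omega> \<in> space M. m + t < h (\<xi> \<omega>)} = 1 - prob {\<omega> \<in> space M. h (\<xi> \<omega>) \<le> m + t}"
  proof -
    have "{\<omega> \<in> space M. m + t < h (\<xi> \<omega>)} = space M - {\<omega> \<in> space M. h (\<xi> \<omega>) \<le> m + t}" by auto
    then show ?thesis by (simp add: prob_compl)
  qed
  ultimately show ?thesis by (simp add: m_def)
qed

subsection \<open>Penalized least squares\<close>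

lemma scaled_norm_eq: "scaled_norm (u :: real ^ 'n) = norm u / sqrt (real CARD('n))"
  by (simp add: scaled_norm_def norm_vec_def L2_set_def real_sqrt_divide)

text \<open>First-order optimality for a possibly nonsmooth \<open>F\<close>: compare
  \<open>b\<close> with the point \<open>t *\<^sub>R c + (1 - t) *\<^sub>R b\<close>, bound
  \<open>F\<close> there by convexity, cancel \<open>2 * t\<close> and let \<open>t\<close> tend to
  0. The factor \<open>CARD('n)\<close> undoes the scaling of the norm.\<close>

lemma penalized_minimizer_variational:
  fixes X :: "real ^ 'p ^ 'n" and y :: "real ^ 'n"
  assumes F: "proper_convex F"
    and b: "is_arg_min (penalized_objective X F y) (\<lambda>b. True) b"
    and fin: "F b < \<infinity>" "F c < \<infinity>"
  shows "(y - X *v b) \<bullet> (X *v c - X *v b) \<le> real CARD('n) * (enn2real (F c) - enn2real (F b))"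
proof -
  define n where "n = real CARD('n)"
  define r d where "r = y - X *v b" and "d = X *v c - X *v b"
  have n: "n > 0" by (simp add: n_def)
  obtain p q where p: "F b = ennreal p" "p \<ge> 0" and q: "F c = ennreal q" "q \<ge> 0"
    using fin by (metis ennreal_cases infinity_ennreal_def order_less_irrefl)
  have sq: "(scaled_norm u)\<^sup>2 = u \<bullet> u / n" for u :: "real ^ 'n"
    by (simp add: scaled_norm_eq power_divide n_def power2_norm_eq_inner)
  have step: "r \<bullet> d \<le> n * (q - p) + t * (d \<bullet> d) / 2" if t: "0 < t" "t \<le> 1" for t
  proof -
    define a where "a = t *\<^sub>R c + (1 - t) *\<^sub>R b"
    have res: "y - X *v a = r - t *\<^sub>R d"
      by (simp add: a_def r_def d_def matrix_vector_right_distrib matrix_vector_mult_scaleR algebra_simps)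
    have "F a \<le> ennreal t * F c + ennreal (1 - t) * F b"
      using F t by (simp add: proper_convex_def a_def)
    also have "\<dots> = ennreal (t * q + (1 - t) * p)"
      using p q t by (simp add: ennreal_mult[symmetric] ennreal_plus[symmetric] del: ennreal_plus)
    finally have Fa: "F a \<le> ennreal (t * q + (1 - t) * p)" .
    have "ennreal (r \<bullet> r / n + 2 * p) = penalized_objective X F y b"
      using p n by (simp add: penalized_objective_def sq r_def ennreal_plus ennreal_mult)
    also have "\<dots> \<le> penalized_objective X F y a"
      using b by (auto simp: is_arg_min_def not_less)
    also have "\<dots> \<le> ennreal ((r - t *\<^sub>R d) \<bullet> (r - t *\<^sub>R d) / n) + 2 * ennreal (t * q + (1 - t) * p)"
      unfolding penalized_objective_def sq res by (intro add_left_mono mult_left_mono Fa) simp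
    also have "\<dots> = ennreal ((r - t *\<^sub>R d) \<bullet> (r - t *\<^sub>R d) / n + 2 * (t * q + (1 - t) * p))"
      using p q t n by (simp add: ennreal_plus ennreal_mult del: inner_diff_left inner_diff_right)
    finally have "r \<bullet> r / n + 2 * p
        \<le> (r - t *\<^sub>R d) \<bullet> (r - t *\<^sub>R d) / n + 2 * (t * q + (1 - t) * p)"
      using p q t n by (subst (asm) ennreal_le_iff) auto
    from mult_right_mono[OF this, of n] have "r \<bullet> r + 2 * p * n \<le> (r - t *\<^sub>R d) \<bullet> (r - t *\<^sub>R d) + 2 * (t * q + (1 - t) * p) * n"
      using n by (simp add: distrib_right)
    also have "(r - t *\<^sub>R d) \<bullet> (r - t *\<^sub>R d) = r \<bullet> r - 2 * t * (r \<bullet> d) + t * t * (d \<bullet> d)"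
      by (simp add: inner_diff_left inner_diff_right inner_commute algebra_simps)
    finally have "2 * t * (r \<bullet> d) \<le> 2 * t * (n * (q - p) + t * (d \<bullet> d) / 2)"
      by (simp add: algebra_simps)
    then show ?thesis using t by (simp add: mult_le_cancel_left)
  qed
  have "((\<lambda>t. n * (q - p) + t * (d \<bullet> d) / 2) \<longlongrightarrow> n * (q - p) + 0 * (d \<bullet> d) / 2) (at_right 0)"
    by (intro tendsto_intros) auto
  moreover have "\<forall>\<^sub>F t in at_right 0. r \<bullet> d \<le> n * (q - p) + t * (d \<bullet> d) / 2"
    unfolding eventually_at_right_field using step by (intro exI[of _ 1]) auto
  ultimately have "r \<bullet> d \<le> n * (q - p)"
    using tendsto_lowerbound[of _ _ "at_right (0::real)"] by force
  then show ?thesis using p q by (simp add: r_def d_def n_def)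
qed

text \<open>A point where \<open>F\<close> is finite bounds the minimum. Finiteness lets
  \<open>enn2real\<close> represent the penalty faithfully in the variational inequality.\<close>

lemma penalized_minimizer_finite:
  assumes F: "proper_convex F"
    and b: "is_arg_min (penalized_objective X F y) (\<lambda>b. True) b"
  shows "F b < \<infinity>"
proof -
  obtain c where "F c < \<infinity>" using F by (auto simp: proper_convex_def)
  then have "penalized_objective X F y c < \<infinity>"
    by (auto simp: penalized_objective_def ennreal_mult_less_top ennreal_add_less_top)
  moreover have "penalized_objective X F y b \<le> penalized_objective X F y c"
    using b by (auto simp: is_arg_min_def not_less)
  ultimately have "penalized_objective X F y b < \<infinity>" by (rule le_less_trans[rotated])
  then show ?thesis
    by (auto simp: penalized_objective_def ennreal_mult_less_top ennreal_add_less_top)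
qed

text \<open>In the variational inequalities for \<open>b\<close> tested at \<open>c\<close> and for
  \<open>c\<close> tested at \<open>b\<close> the penalties cancel on addition; Cauchy-Schwarz
  finishes. For \<open>z = y\<close> this shows that all minimizers have the same fitted value, and
  continuity in the data is what makes the loss measurable.\<close>

lemma fitted_values_nonexpansive:
  fixes X :: "real ^ 'p ^ 'n"
  assumes F: "proper_convex F"
    and b: "is_arg_min (penalized_objective X F y) (\<lambda>b. True) b"
    and c: "is_arg_min (penalized_objective X F z) (\<lambda>b. True) c"
  shows "norm (X *v b - X *v c) \<le> norm (y - z)"
proof -
  define e where "e = X *v b - X *v c"
  note fin = penalized_minimizer_finite[OF F b] penalized_minimizer_finite[OF F c]
  have "(y - X *v b) \<bullet> (X *v c - X *v b) + (z - X *v c) \<bullet> (X *v b - X *v c) \<le> 0"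
    using penalized_minimizer_variational[OF F b fin] penalized_minimizer_variational[OF F c fin(2,1)]
    by (simp add: algebra_simps)
  then have "e \<bullet> e \<le> (y - z) \<bullet> e"
    by (simp add: e_def inner_diff_left inner_diff_right algebra_simps)
  also have "\<dots> \<le> norm (y - z) * norm e" by (rule norm_cauchy_schwarz)
  finally have "norm e * norm e \<le> norm (y - z) * norm e"
    by (simp add: power2_norm_eq_inner[symmetric] power2_eq_square)
  then have "norm e \<le> norm (y - z)"
    by (cases "norm e = 0") (auto simp: mult_le_cancel_right)
  then show ?thesis by (simp add: e_def)
qed

section \<open>The two tail bounds for the loss\<close>

theorem mainTheorem7:
  fixes X :: "real ^ 'p ^ 'n"
    and f :: "real ^ 'n"
    and \<sigma> x :: real
    and M :: "'a measure"
    and \<xi> :: "'a \<Rightarrow> real ^ 'n"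
    and F :: "real ^ 'p \<Rightarrow> ennreal"
    and betahat :: "real ^ 'n \<Rightarrow> real ^ 'p"
  assumes "prob_space M"
    and "\<sigma> > 0"
    and "isotropic_normal M \<sigma> \<xi>"
    and "proper_convex F"
    and "\<And>y. is_arg_min (penalized_objective X F y) (\<lambda>b. True) (betahat y)"
    and "x > 0"
  shows "measure M {\<omega> \<in> space M.
            scaled_norm (X *v betahat (f + \<xi> \<omega>) - f)
              \<le> (\<integral>\<omega>'. scaled_norm (X *v betahat (f + \<xi> \<omega>') - f) \<partial>M)
                 + \<sigma> * sqrt (2 * x / real CARD('n))}
          \<ge> 1 - exp (- x)
       \<and> measure M {\<omega> \<in> space M.
            scaled_norm (X *v betahat (f + \<xi> \<omega>) - f)
              \<ge> (\<integral>\<omega>'. scaled_norm (X *v betahat (f + \<xi> \<omega>') - f) \<partial>M)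
                 - \<sigma> * sqrt (2 * x / real CARD('n))}
          \<ge> 1 - exp (- x)"
proof -
  \<comment> \<open>The factor between the scaled and the Euclidean norm; the loss inherits it as
    Lipschitz constant because the fit is nonexpansive.\<close>
  define L where "L = 1 / sqrt (real CARD('n))"
  define h where "h v = scaled_norm (X *v betahat (f + v) - f)" for v
  \<comment> \<open>Chosen so that the Gaussian exponent \<open>t^2 / (2 * L^2 * \<sigma>^2)\<close>
    equals \<open>x\<close>.\<close>
  define t where "t = \<sigma> * sqrt (2 * x / real CARD('n))"
  have L: "L > 0" by (simp add: L_def)
  have t: "t \<ge> 0" using assms(2,6) by (simp add: t_def)
  have h: "L-lipschitz_on UNIV h"
  proof (rule lipschitz_onI)
    fix u v
    have "\<bar>h u - h v\<bar> = \<bar>norm (X *v betahat (f + u) - f) - norm (X *v betahat (f + v) - f)\<bar> * L"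
      using L by (simp add: h_def scaled_norm_eq L_def diff_divide_distrib[symmetric] abs_divide)
    also have "\<dots> \<le> norm (X *v betahat (f + u) - X *v betahat (f + v)) * L"
      using norm_triangle_ineq3[of "X *v betahat (f + u) - f" "X *v betahat (f + v) - f"] L
      by (intro mult_right_mono) auto
    also have "\<dots> \<le> norm ((f + u) - (f + v)) * L"
      using L by (intro mult_right_mono fitted_values_nonexpansive[OF assms(4,5,5)]) auto
    finally show "dist (h u) (h v) \<le> L * dist u v"
      by (simp add: dist_real_def dist_norm mult.commute)
  qed (use L in simp)
  \<comment> \<open>The lower tail of \<open>h\<close> is the upper tail of \<open>- h\<close>,
    which has the same Lipschitz constant.\<close>
  have h': "L-lipschitz_on UNIV (\<lambda>v. - h v)"
    using lipschitz_on_minus[OF h] by simp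
  have "t\<^sup>2 / (2 * L\<^sup>2 * \<sigma>\<^sup>2) = x"
    using assms(2,6) by (simp add: t_def L_def power_mult_distrib power_divide)
  then have
    "1 - exp (- x) \<le> measure M {\<omega> \<in> space M. h (\<xi> \<omega>) \<le> (\<integral>\<omega>. h (\<xi> \<omega>) \<partial>M) + t}"
    "1 - exp (- x) \<le> measure M {\<omega> \<in> space M. - h (\<xi> \<omega>) \<le> (\<integral>\<omega>. - h (\<xi> \<omega>) \<partial>M) + t}"
    using isotropic_normal_lipschitz_upper_tail[OF assms(1-3) h L t]
      isotropic_normal_lipschitz_upper_tail[OF assms(1-3) h' L t] by simp_all
  moreover have "{\<omega> \<in> space M. - h (\<xi> \<omega>) \<le> (\<integral>\<omega>. - h (\<xi> \<omega>) \<partial>M) + t}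
      = {\<omega> \<in> space M. h (\<xi> \<omega>) \<ge> (\<integral>\<omega>. h (\<xi> \<omega>) \<partial>M) - t}"
    by (auto simp: algebra_simps)
  ultimately show ?thesis by (simp add: h_def t_def)
qed

end
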